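(* The class of cometrizable topological spaces contains all metrizable spaces, and it is closed under taking subspaces and under countable Tychonoff products. That is: every metrizable space is cometrizable; every subspace of a cometrizable space is cometrizable; and the Tychonoff product of any countable family of cometrizable spaces is cometrizable.
   Context: A topological space $X$ is called cometrizable if it admits a weaker (i.e. contained in the original topology) metrizable topology such that each point $x\in X$ has a (not necessarily open) neighborhood base, with respect to the original topology of $X$, consisting of sets that are closed in the metrizable topology. Equivalently, there is a continuous bijective map $f:X\to M$ onto a metrizable space $M$ such that for any open set $U\subseteq X$ and point $x\in U$ there exists a neighborhood $V\subseteq X$ of $x$ with $f^{-1}(\overline{f(V)})\subseteq U$. *)

theory Defs
  imports "HOL-Analysis.Analysis"
begin

(* M is a weaker metrizable topology on the same point set.  In neighbourhood_base_of the
   members of the base need not be open: they only have to contain an open neighbourhood,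
   with respect to X, of the point. *)
definition cometrizable_space :: "'a topology \<Rightarrow> bool" where
  "cometrizable_space X \<longleftrightarrow>
     (\<exists>M. metrizable_space M \<and> topspace M = topspace X \<and>
          (\<forall>U. openin M U \<longrightarrow> openin X U) \<and>
          neighbourhood_base_of (closedin M) X)"

end

theory Submission
  imports Defs
begin

text \<open>
  A witness of cometrizability is a metrizable topology \<^term>\<open>M\<close> on the same points, and in each of
  the three cases such a witness arises by the construction that produces the space.  A metrizable
  topology is its own witness, because it is regular.  For a subspace, the trace of \<^term>\<open>M\<close> is a
  witness: tracing a base of closed neighbourhoods gives a base of closed neighbourhoods.  For a
  countable product, the product of the witnesses is metrizable; this is where countability enters.
  A basic open box in the product of the original topologies restricts only finitely many
  coordinates, and shrinking it in just those coordinates to closed neighbourhoods gives a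
  neighbourhood that is still a box over finitely many coordinates, while a box with closed sides
  is closed in a product however many sides it has.
\<close>

lemma metrizable_imp_cometrizable_space:
  assumes "metrizable_space X"
  shows "cometrizable_space X"
  unfolding cometrizable_space_def
  using assms metrizable_imp_regular_space neighbourhood_base_of_closedin by blast

text \<open>
  Every relatively open set is the trace of an open set of the whole space, so it can be shrunk
  there and the result intersected with \<^term>\<open>S\<close>.
\<close>

lemma neighbourhood_base_of_closedin_subtopology:
  assumes "neighbourhood_base_of (closedin M) X"
  shows "neighbourhood_base_of (closedin (subtopology M S)) (subtopology X S)"
  unfolding neighbourhood_base_of
proof (intro allI impI)
  fix W x
  assume "openin (subtopology X S) W \<and> x \<in> W"
  then obtain T where T: "openin X T" "W = T \<inter> S" "x \<in> T" "x \<in> S"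
    by (auto simp: openin_subtopology)
  then obtain U V where "openin X U" "closedin M V" "x \<in> U" "U \<subseteq> V" "V \<subseteq> T"
    using assms unfolding neighbourhood_base_of by meson
  with T show "\<exists>U V. openin (subtopology X S) U \<and> closedin (subtopology M S) V \<and>
                 x \<in> U \<and> U \<subseteq> V \<and> V \<subseteq> W"
    by (intro exI[of _ "U \<inter> S"] exI[of _ "V \<inter> S"])
       (auto simp: openin_subtopology closedin_subtopology)
qed

lemma cometrizable_space_subtopology:
  assumes "cometrizable_space X"
  shows "cometrizable_space (subtopology X S)"
proof -
  obtain M where M: "metrizable_space M" "topspace M = topspace X"
      "\<And>U. openin M U \<Longrightarrow> openin X U" "neighbourhood_base_of (closedin M) X"
    using assms unfolding cometrizable_space_def by blast
  show ?thesis
    unfolding cometrizable_space_def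
  proof (intro exI[of _ "subtopology M S"] conjI)
    show "\<forall>U. openin (subtopology M S) U \<longrightarrow> openin (subtopology X S) U"
      using M(3) by (auto simp: openin_subtopology)
  qed (simp_all add: M metrizable_space_subtopology neighbourhood_base_of_closedin_subtopology)
qed

lemma openin_product_topology_mono:
  assumes top: "\<And>i. i \<in> I \<Longrightarrow> topspace (M i) = topspace (X i)"
    and weaker: "\<And>i U. i \<in> I \<Longrightarrow> openin (M i) U \<Longrightarrow> openin (X i) U"
    and "openin (product_topology M I) W"
  shows "openin (product_topology X I) W"
  unfolding openin_product_topology_alt
proof
  fix x
  assume "x \<in> W"
  then obtain U where U: "finite {i \<in> I. U i \<noteq> topspace (M i)}"
      "\<forall>i\<in>I. openin (M i) (U i)" "x \<in> Pi\<^sub>E I U" "Pi\<^sub>E I U \<subseteq> W"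
    using assms(3) unfolding openin_product_topology_alt by meson
  moreover have "{i \<in> I. U i \<noteq> topspace (M i)} = {i \<in> I. U i \<noteq> topspace (X i)}"
    using top by auto
  ultimately show "\<exists>U. finite {i \<in> I. U i \<noteq> topspace (X i)} \<and> (\<forall>i\<in>I. openin (X i) (U i)) \<and>
                     x \<in> Pi\<^sub>E I U \<and> Pi\<^sub>E I U \<subseteq> W"
    using weaker by (intro exI[of _ U]) auto
qed

text \<open>
  The inner neighbourhoods must form an open box, so only finitely many of its sides may be proper.
  Hence a side that is the whole factor must not be shrunk; the equality of the underlying sets
  makes the whole factor closed for the other topology.
\<close>

lemma neighbourhood_base_of_closedin_product_topology:
  assumes top: "\<And>i. i \<in> I \<Longrightarrow> topspace (M i) = topspace (X i)"
    and base: "\<And>i. i \<in> I \<Longrightarrow> neighbourhood_base_of (closedin (M i)) (X i)"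
  shows "neighbourhood_base_of (closedin (product_topology M I)) (product_topology X I)"
  unfolding neighbourhood_base_of
proof (intro allI impI)
  fix W x
  assume "openin (product_topology X I) W \<and> x \<in> W"
  then obtain B where B: "finite {i \<in> I. B i \<noteq> topspace (X i)}"
      "\<And>i. i \<in> I \<Longrightarrow> openin (X i) (B i)" "x \<in> Pi\<^sub>E I B" "Pi\<^sub>E I B \<subseteq> W"
    unfolding openin_product_topology_alt by meson
  have "\<exists>U V. openin (X i) U \<and> closedin (M i) V \<and> x i \<in> U \<and> U \<subseteq> V \<and> V \<subseteq> B i \<and>
          (B i = topspace (X i) \<longrightarrow> U = topspace (X i))" if "i \<in> I" for i
  proof (cases "B i = topspace (X i)")
    case True
    moreover have "closedin (M i) (topspace (X i))"
      using top[OF that] closedin_topspace[of "M i"] by simp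
    moreover have "x i \<in> B i"
      using B(3) that by auto
    ultimately show ?thesis
      by (intro exI[of _ "topspace (X i)"]) auto
  next
    case False
    have "x i \<in> B i"
      using B(3) that by auto
    then show ?thesis
      using base[OF that] B(2)[OF that] False unfolding neighbourhood_base_of by meson
  qed
  then obtain U V where UV: "\<And>i. i \<in> I \<Longrightarrow> openin (X i) (U i) \<and> closedin (M i) (V i) \<and>
      x i \<in> U i \<and> U i \<subseteq> V i \<and> V i \<subseteq> B i \<and> (B i = topspace (X i) \<longrightarrow> U i = topspace (X i))"
    by metis
  have "{i \<in> I. U i \<noteq> topspace (X i)} \<subseteq> {i \<in> I. B i \<noteq> topspace (X i)}"
    using UV by auto
  then have "finite {i \<in> I. U i \<noteq> topspace (X i)}"
    using B(1) finite_subset by blast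
  then have "openin (product_topology X I) (Pi\<^sub>E I U)"
    unfolding openin_PiE_gen using UV by auto
  moreover have "closedin (product_topology M I) (Pi\<^sub>E I V)"
    unfolding closedin_product_topology using UV by auto
  moreover have "x \<in> Pi\<^sub>E I U"
    using B(3) UV by (auto simp: PiE_iff)
  moreover have "Pi\<^sub>E I U \<subseteq> Pi\<^sub>E I V" "Pi\<^sub>E I V \<subseteq> Pi\<^sub>E I B"
    using UV by (auto intro!: PiE_mono)
  ultimately show "\<exists>U V. openin (product_topology X I) U \<and> closedin (product_topology M I) V \<and>
                     x \<in> U \<and> U \<subseteq> V \<and> V \<subseteq> W"
    using B(4) by (meson order_trans)
qed

lemma cometrizable_space_product_topology:
  assumes "countable I" "\<And>i. i \<in> I \<Longrightarrow> cometrizable_space (X i)"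
  shows "cometrizable_space (product_topology X I)"
proof -
  have "\<forall>i\<in>I. \<exists>M. metrizable_space M \<and> topspace M = topspace (X i) \<and>
          (\<forall>U. openin M U \<longrightarrow> openin (X i) U) \<and> neighbourhood_base_of (closedin M) (X i)"
    using assms(2) unfolding cometrizable_space_def by blast
  then obtain M where M: "\<And>i. i \<in> I \<Longrightarrow> metrizable_space (M i)"
      "\<And>i. i \<in> I \<Longrightarrow> topspace (M i) = topspace (X i)"
      "\<And>i U. i \<in> I \<Longrightarrow> openin (M i) U \<Longrightarrow> openin (X i) U"
      "\<And>i. i \<in> I \<Longrightarrow> neighbourhood_base_of (closedin (M i)) (X i)"
    by metis
  show ?thesis
    unfolding cometrizable_space_def
  proof (intro exI[of _ "product_topology M I"] conjI)
    show "metrizable_space (product_topology M I)"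
      unfolding metrizable_space_product_topology
      using M(1) assms(1) by (auto intro: countable_subset)
    show "topspace (product_topology M I) = topspace (product_topology X I)"
      using M(2) by (auto intro!: PiE_cong)
    show "\<forall>U. openin (product_topology M I) U \<longrightarrow> openin (product_topology X I) U"
      using openin_product_topology_mono M(2,3) by blast
    show "neighbourhood_base_of (closedin (product_topology M I)) (product_topology X I)"
      using neighbourhood_base_of_closedin_product_topology M(2,4) by blast
  qed
qed

theorem proposition1p2:
  shows "(\<forall>X :: 'a topology. metrizable_space X \<longrightarrow> cometrizable_space X) \<and>
    (\<forall>(X :: 'b topology) S. cometrizable_space X \<longrightarrow> cometrizable_space (subtopology X S)) \<and>
    (\<forall>(I :: 'i set) (X :: 'i \<Rightarrow> 'c topology).
        countable I \<and> (\<forall>i\<in>I. cometrizable_space (X i)) \<longrightarrow>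
        cometrizable_space (product_topology X I))"
  by (simp add: metrizable_imp_cometrizable_space cometrizable_space_subtopology
      cometrizable_space_product_topology)

end
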